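(* Consider the averaged conservative Keplerian spin-orbit model (coupling parameter $\chi=0$) in the $(1:1,3:2)$ resonance, linearized at the critical point $(\varphi_1,\varphi_2,J_1,J_2)=(0,0,0,0)$, that is, the linear system in $(\xi_1,\xi_2,J_1,J_2)$ $$\dot\xi_1=\frac{2}{C_1}J_1,\qquad \dot\xi_2=\frac{2}{C_2}J_2,\qquad \dot J_1=-K_1\,\xi_1,\qquad \dot J_2=-L_1\,\xi_2,$$ where $$K_1=\frac{3d_1GM_2}{2a^3}\Bigl(1-\frac52e^2\Bigr),\qquad L_1=\frac{21d_2eGM_1}{4a^3}.$$ For $e<\sqrt{2/5}$, the eigenvalues of this linear system are purely imaginary.
   Context: Two homogeneous rigid ellipsoids $\mathcal E_1,\mathcal E_2$ with masses $M_1,M_2$ and principal moments of inertia $A_j\le B_j\le C_j$ ($j=1,2$) move on a Keplerian orbit with semimajor axis $a$ and eccentricity $e$; the spin axis of each body is perpendicular to the orbital plane and has the direction of its shortest physical axis. Units are normalized so that $M_1+M_2=1$, $C_1+C_2=1$ and the orbital period is $2\pi$, so that the gravitational constant is $G=a^3$. Put $d_j=B_j-A_j$; one has $0\le d_j\le C_j\le 1$. If $\theta_j$ are the rotation angles and $t$ is time, the resonant angles for the $(1:1,3:2)$ resonance are $\varphi_1=2\theta_1-2t$, $\varphi_2=2\theta_2-3t$. Expanding the potential to second order in $e$ and keeping only the terms that do not vanish after averaging over time, the conservative equations for $\chi=0$ are $\dot\varphi_1=\frac{2}{C_1}J_1$, $\dot\varphi_2=\frac{2}{C_2}J_2$, $\dot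 J_1=-K_1\sin\varphi_1$, $\dot J_2=-L_1\sin\varphi_2$; $\xi_j$ denotes the small displacement of $\varphi_j$ from the critical point. *)

theory Defs
  imports "HOL-Analysis.Product_Vector" "Jordan_Normal_Form.Char_Poly"
begin

text \<open>Here \<open>d1 = B1 - A1\<close> and \<open>d2 = B2 - A2\<close> are differences of the two
  smaller principal moments of inertia, and \<open>G\<close> is the gravitational constant.\<close>

definition K1_coeff :: "real \<Rightarrow> real \<Rightarrow> real \<Rightarrow> real \<Rightarrow> real \<Rightarrow> real" where
  "K1_coeff G a e M2 d1 = 3 * d1 * G * M2 / (2 * a ^ 3) * (1 - 5 / 2 * e ^ 2)"

definition L1_coeff :: "real \<Rightarrow> real \<Rightarrow> real \<Rightarrow> real \<Rightarrow> real \<Rightarrow> real" where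
  "L1_coeff G a e M1 d2 = 21 * d2 * e * G * M1 / (4 * a ^ 3)"

text \<open>Coordinates are ordered as \<open>(\<phi>1, \<phi>2, J1, J2)\<close>, and as
  \<open>(\<xi>1, \<xi>2, J1, J2)\<close> for the linearization.\<close>

definition averaged_field ::
  "real \<Rightarrow> real \<Rightarrow> real \<Rightarrow> real \<Rightarrow> real \<times> real \<times> real \<times> real \<Rightarrow> real \<times> real \<times> real \<times> real" where
  "averaged_field C1 C2 K L =
     (\<lambda>(\<phi>1, \<phi>2, J1, J2). (2 / C1 * J1, 2 / C2 * J2, - K * sin \<phi>1, - L * sin \<phi>2))"

definition linearized_field ::
  "real \<Rightarrow> real \<Rightarrow> real \<Rightarrow> real \<Rightarrow> real \<times> real \<times> real \<times> real \<Rightarrow> real \<times> real \<times> real \<times> real" where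
  "linearized_field C1 C2 K L =
     (\<lambda>(\<xi>1, \<xi>2, J1, J2). (2 / C1 * J1, 2 / C2 * J2, - K * \<xi>1, - L * \<xi>2))"

definition linearized_matrix :: "real \<Rightarrow> real \<Rightarrow> real \<Rightarrow> real \<Rightarrow> real mat" where
  "linearized_matrix C1 C2 K L = mat_of_rows_list 4
     [[0, 0, 2 / C1, 0],
      [0, 0, 0, 2 / C2],
      [- K, 0, 0, 0],
      [0, - L, 0, 0]]"

lemma averaged_field_critical: "averaged_field C1 C2 K L (0, 0, 0, 0) = (0, 0, 0, 0)"
  by (simp add: averaged_field_def)

lemma averaged_field_linearization:
  assumes "C1 \<noteq> 0" "C2 \<noteq> 0"
  shows "(averaged_field C1 C2 K L has_derivative linearized_field C1 C2 K L) (at (0, 0, 0, 0))"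
  using assms
  unfolding averaged_field_def linearized_field_def case_prod_beta
  by (auto intro!: derivative_eq_intros simp: fun_eq_iff)

lemma linearized_matrix_mult:
  assumes "linearized_field C1 C2 K L (x1, x2, x3, x4) = (y1, y2, y3, y4)"
  shows "linearized_matrix C1 C2 K L *\<^sub>v vec_of_list [x1, x2, x3, x4] = vec_of_list [y1, y2, y3, y4]"
proof -
  have [simp]: "{0..<4::nat} = {0, 1, 2, 3}" by auto
  show ?thesis
    using assms
    by (intro eq_vecI)
      (auto simp: linearized_matrix_def linearized_field_def mat_of_rows_list_def scalar_prod_def
        vec_of_list_index less_Suc_eq numeral_eq_Suc)
qed

end

theory Submission
  imports Defs
begin

text \<open>The linear system decouples into two harmonic oscillators \<open>\<xi>1'' = - (2 K / C1) \<xi>1\<close> and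
  \<open>\<xi>2'' = - (2 L / C2) \<xi>2\<close>, so every eigenvalue is a square root of \<open>- 2 K / C1\<close> or \<open>- 2 L / C2\<close>.
  The bound on \<open>e\<close> makes \<open>K\<close> nonnegative.\<close>

lemma eigenvalue_linearized_matrix_square:
  assumes C: "C1 \<noteq> 0" "C2 \<noteq> 0"
    and eigen: "eigenvalue (map_mat complex_of_real (linearized_matrix C1 C2 K L)) \<mu>"
  shows "\<mu>\<^sup>2 = - complex_of_real (2 * K / C1) \<or> \<mu>\<^sup>2 = - complex_of_real (2 * L / C2)"
proof -
  let ?A = "map_mat complex_of_real (linearized_matrix C1 C2 K L)"
  have dims: "dim_row ?A = 4" "dim_col ?A = 4"
    by (simp_all add: linearized_matrix_def mat_of_rows_list_def)
  obtain v where v: "v \<in> carrier_vec 4" "v \<noteq> 0\<^sub>v 4" "?A *\<^sub>v v = \<mu> \<cdot>\<^sub>v v"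
    using eigen dims unfolding eigenvalue_def eigenvector_def by auto
  have [simp]: "{0..<4::nat} = {0, 1, 2, 3}" by auto
  have dim_v: "dim_vec v = 4" using v(1) by simp
  have row: "(?A *\<^sub>v v) $ i = \<mu> * v $ i" if "i < 4" for i
    using that dim_v unfolding v(3) by simp
  have rows:
    "2 / complex_of_real C1 * v $ 2 = \<mu> * v $ 0"
    "2 / complex_of_real C2 * v $ 3 = \<mu> * v $ 1"
    "- complex_of_real K * v $ 0 = \<mu> * v $ 2"
    "- complex_of_real L * v $ 1 = \<mu> * v $ 3"
    using row[of 0] row[of 1] row[of 2] row[of 3] dim_v
    by (simp_all add: linearized_matrix_def mat_of_rows_list_def scalar_prod_def numeral_eq_Suc)
  show ?thesis
  \<comment> \<open>Entries 0 and 1 of \<open>v\<close> are the angles, 2 and 3 the momenta. As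
    \<open>C1\<close> and \<open>C2\<close> are nonzero, vanishing angles force vanishing momenta,
    which an eigenvector excludes.\<close>
  proof (cases "v $ 0 = 0 \<and> v $ 1 = 0")
    case True
    then have "v $ 2 = 0" "v $ 3 = 0" using rows(1,2) C by auto
    with True have "v = 0\<^sub>v 4"
      using dim_v by (intro eq_vecI) (auto simp: less_Suc_eq numeral_eq_Suc)
    with v(2) show ?thesis by simp
  next
    case False
    \<comment> \<open>Eliminate the momentum: scale its row by \<open>2 / C1\<close> and substitute
      the angle row. A nonzero angle can then be cancelled.\<close>
    have "\<mu>\<^sup>2 * v $ 0 = - complex_of_real (2 * K / C1) * v $ 0"
      unfolding power2_eq_square mult.assoc rows(1)[symmetric]
      using arg_cong[OF rows(3), of "\<lambda>z. 2 / complex_of_real C1 * z"] by (simp add: mult_ac)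
    moreover have "\<mu>\<^sup>2 * v $ 1 = - complex_of_real (2 * L / C2) * v $ 1"
      unfolding power2_eq_square mult.assoc rows(2)[symmetric]
      using arg_cong[OF rows(4), of "\<lambda>z. 2 / complex_of_real C2 * z"] by (simp add: mult_ac)
    ultimately show ?thesis using False by (metis mult_right_cancel)
  qed
qed

text \<open>The square is real, so \<open>Re z * Im z = 0\<close>. If \<open>Re z\<close> were
  nonzero, \<open>z\<close> would be real with a positive square.\<close>

lemma Re_eq_0_if_square_nonpos:
  assumes "z\<^sup>2 = - complex_of_real r" "0 \<le> r"
  shows "Re z = 0"
proof (rule ccontr)
  assume nz: "Re z \<noteq> 0"
  have "Re z * Im z = 0" using arg_cong[OF assms(1), of Im] by (auto simp: power2_eq_square)
  moreover have "(Re z)\<^sup>2 - (Im z)\<^sup>2 = - r" using arg_cong[OF assms(1), of Re] by (simp add: power2_eq_square)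
  ultimately have "(Re z)\<^sup>2 \<le> 0" using nz assms(2) by simp
  with nz show False by simp
qed

text \<open>If \<open>A1 = B1\<close>, \<open>A2 = B2\<close> or \<open>e = 0\<close>, then a
  stiffness \<open>K\<close> or \<open>L\<close> vanishes and 0 is an eigenvalue; hence the nonzero
  claim is conditional.\<close>

theorem proposition9:
  fixes M1 M2 A1 B1 C1 A2 B2 C2 a e G :: real and \<mu> :: complex
  assumes masses: "0 < M1" "0 < M2" "M1 + M2 = 1"
    and moments1: "0 < A1" "A1 \<le> B1" "B1 \<le> C1"
    and moments2: "0 < A2" "A2 \<le> B2" "B2 \<le> C2"
    and C_norm: "C1 + C2 = 1"
    and orbit: "0 < a" "G = a ^ 3" "0 \<le> e"
    and ecc: "e < sqrt (2 / 5)"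
    and eigen: "eigenvalue
      (map_mat complex_of_real
        (linearized_matrix C1 C2
          (K1_coeff G a e M2 (B1 - A1)) (L1_coeff G a e M1 (B2 - A2)))) \<mu>"
  shows "Re \<mu> = 0 \<and> (A1 < B1 \<and> A2 < B2 \<and> 0 < e \<longrightarrow> \<mu> \<noteq> 0)"
proof -
  have C: "0 < C1" "0 < C2" using moments1 moments2 by linarith+
  \<comment> \<open>The threshold \<open>sqrt (2 / 5)\<close> is the positive zero of the factor
    \<open>1 - 5 / 2 * e ^ 2\<close> in \<open>K1_coeff\<close>.\<close>
  have "e\<^sup>2 < 2 / 5"
    using real_less_rsqrt ecc orbit(3) by (metis not_less real_le_lsqrt real_le_rsqrt)
  then have E: "0 < 1 - 5 / 2 * e\<^sup>2" by simp
  define K where "K = K1_coeff G a e M2 (B1 - A1)"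
  define L where "L = L1_coeff G a e M1 (B2 - A2)"
  have "0 \<le> K" "0 \<le> L"
    using masses moments1 moments2 orbit E by (simp_all add: K_def L_def K1_coeff_def L1_coeff_def)
  then have nonneg: "0 \<le> 2 * K / C1" "0 \<le> 2 * L / C2" using C by simp_all
  have sq: "\<mu>\<^sup>2 = - complex_of_real (2 * K / C1) \<or> \<mu>\<^sup>2 = - complex_of_real (2 * L / C2)"
    using eigenvalue_linearized_matrix_square[of C1 C2 K L \<mu>] C eigen
    unfolding K_def L_def by simp
  have "Re \<mu> = 0" using sq nonneg Re_eq_0_if_square_nonpos by blast
  moreover have "\<mu> \<noteq> 0" if "A1 < B1" "A2 < B2" "0 < e"
  proof -
    \<comment> \<open>Strict positivity makes both candidate values of the square negative.\<close>
    have "0 < K" "0 < L"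
      using that masses orbit E by (simp_all add: K_def L_def K1_coeff_def L1_coeff_def)
    with sq C show ?thesis by auto
  qed
  ultimately show ?thesis by blast
qed

end
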